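(* Let $G$ be a connected, non-complete graph of order $n$. Then $1\leq mvd(G)\leq n-\kappa^{+}(G)+1\leq n-\kappa(G)+1$.
   Context: All graphs are finite, simple, undirected and connected. For a graph $G$ with a vertex-coloring (an arbitrary assignment of colors to vertices) and two nonadjacent vertices $x,y$, an $x$-$y$ vertex cut is a set $S\subseteq V(G)\setminus\{x,y\}$ such that $x$ and $y$ lie in different components of $G-S$; it is monochromatic if all vertices of $S$ receive the same color. The coloring is an MVD-coloring if every pair of nonadjacent vertices $x,y$ has a monochromatic $x$-$y$ vertex cut. The monochromatic vertex-disconnection number $mvd(G)$ is the maximum number of colors used by an MVD-coloring of $G$. For nonadjacent $x,y$, $\kappa(x,y)$ denotes the minimum size of an $x$-$y$ vertex cut, and $\kappa^{+}(G)$ denotes the maximum of $\kappa(x,y)$ over all pairs of nonadjacent vertices $x,y$ of $G$. $\kappa(G)$ is the (vertex) connectivity of $G$. *)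

theory Defs
  imports "Graph_Theory.Graph_Theory"
begin

text \<open>
  A finite simple undirected graph is a digraph satisfying the locale predicate \<open>graph\<close>: finite,
  loop-free, without parallel arcs and with a symmetric arc relation. In such a graph the strongly
  connected component \<open>scc_of x\<close> of a vertex \<open>x\<close> is its ordinary connected component.
\<close>

definition nonadjacent :: "('a, 'b) pre_digraph \<Rightarrow> 'a \<Rightarrow> 'a \<Rightarrow> bool" where
  "nonadjacent G x y \<longleftrightarrow> x \<in> verts G \<and> y \<in> verts G \<and> x \<noteq> y \<and> \<not> x \<rightarrow>\<^bsub>G\<^esub> y"

definition delete_verts :: "('a, 'b) pre_digraph \<Rightarrow> 'a set \<Rightarrow> ('a, 'b) pre_digraph" where
  "delete_verts G S = G \<restriction> (verts G - S)"

definition vertex_cut :: "('a, 'b) pre_digraph \<Rightarrow> 'a \<Rightarrow> 'a \<Rightarrow> 'a set \<Rightarrow> bool" where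
  "vertex_cut G x y S \<longleftrightarrow> S \<subseteq> verts G - {x, y} \<and>
     pre_digraph.scc_of (delete_verts G S) x \<noteq> pre_digraph.scc_of (delete_verts G S) y"

definition monochromatic :: "('a \<Rightarrow> nat) \<Rightarrow> 'a set \<Rightarrow> bool" where
  "monochromatic c S \<longleftrightarrow> (\<forall>u\<in>S. \<forall>v\<in>S. c u = c v)"

definition mvd_coloring :: "('a, 'b) pre_digraph \<Rightarrow> ('a \<Rightarrow> nat) \<Rightarrow> bool" where
  "mvd_coloring G c \<longleftrightarrow>
     (\<forall>x y. nonadjacent G x y \<longrightarrow> (\<exists>S. vertex_cut G x y S \<and> monochromatic c S))"

definition mvd :: "('a, 'b) pre_digraph \<Rightarrow> nat" where
  "mvd G = Max {card (c ` verts G) | c. mvd_coloring G c}"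

definition local_connectivity :: "('a, 'b) pre_digraph \<Rightarrow> 'a \<Rightarrow> 'a \<Rightarrow> nat" where
  "local_connectivity G x y = Min {card S | S. vertex_cut G x y S}"

definition max_local_connectivity :: "('a, 'b) pre_digraph \<Rightarrow> nat" where
  "max_local_connectivity G = Max {local_connectivity G x y | x y. nonadjacent G x y}"

text \<open>
  The second disjunct gives the usual value \<open>n - 1\<close> for complete graphs. The predicate
  \<open>connected\<close> of digraphs is false on the graph without vertices.
\<close>

definition vertex_connectivity :: "('a, 'b) pre_digraph \<Rightarrow> nat" where
  "vertex_connectivity G = Min {card S | S. S \<subseteq> verts G \<and>
     (\<not> Digraph_Component.connected (delete_verts G S) \<or> card (verts G - S) = 1)}"

end

theory Submission
  imports Defs
begin

text \<open>
  A monochromatic cut \<open>S\<close> between two nonadjacent vertices carries at most one color, so a coloring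
  admitting it uses at most \<open>1 + (n - |S|)\<close> colors; applied to a pair attaining \<open>\<kappa>\<^sup>+\<close>, this is the
  upper bound. The remaining inequalities hold because deleting all vertices but two nonadjacent
  ones separates them, and because an \<open>x\<close>-\<open>y\<close> cut disconnects the graph.
\<close>

text \<open>Arcs of a loop-free graph always join distinct vertices, so completeness can only fail
  because some ordered pair of distinct vertices carries no arc.\<close>

lemma nonadjacent_if_not_complete:
  assumes "graph G" "\<not> complete_digraph (card (verts G)) G"
  obtains x y where "nonadjacent G x y"
proof -
  interpret graph G by fact
  have "arcs_ends G \<subseteq> {(u, v). (u, v) \<in> verts G \<times> verts G \<and> u \<noteq> v}"
    using adj_in_verts adj_not_same by auto
  then show ?thesis
    using assms that unfolding complete_digraph_def nonadjacent_def by auto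
qed

text \<open>Only \<open>x\<close> and \<open>y\<close> survive the deletion, and no arc leads from
  \<open>x\<close> to \<open>y\<close>. This cut makes the sets under \<open>Min\<close> and
  \<open>Max\<close> below nonempty.\<close>

lemma vertex_cut_all_other_verts:
  assumes "wf_digraph G" "nonadjacent G x y"
  shows "vertex_cut G x y (verts G - {x, y})"
proof -
  let ?H = "delete_verts G (verts G - {x, y})"
  interpret wf_digraph G by fact
  have H: "?H = G \<restriction> {x, y}"
    using assms(2) unfolding delete_verts_def nonadjacent_def by (simp add: double_diff)
  interpret H: wf_digraph ?H
    unfolding H by (rule wellformed_induce_subgraph)
  \<comment> \<open>Induction along the walk: a step from \<open>x\<close> ends in \<open>x\<close>
    or \<open>y\<close>, and nonadjacency excludes \<open>y\<close>.\<close>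
  have stay: "v = x" if "x \<rightarrow>\<^sup>*\<^bsub>?H\<^esub> v" for v
    using that
  proof (induction rule: H.reachable_induct)
    case (step u v)
    then have "x \<rightarrow>\<^bsub>?H\<^esub> v" by simp
    then have "x \<rightarrow>\<^bsub>G\<^esub> v" "v \<in> {x, y}"
      unfolding H by (auto simp: arcs_ends_conv)
    then show ?case
      using assms(2) unfolding nonadjacent_def by auto
  qed simp
  have "y \<in> H.scc_of y"
    by (rule H.in_scc_of_self) (simp add: H)
  moreover have "y \<notin> H.scc_of x"
    using stay[of y] assms(2) unfolding H.scc_of_def nonadjacent_def by auto
  ultimately show ?thesis
    unfolding vertex_cut_def by auto
qed

lemma vertex_cut_imp_disconnected:
  assumes "sym_digraph G" "nonadjacent G x y" "vertex_cut G x y S"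
  shows "\<not> Digraph_Component.connected (delete_verts G S)"
proof
  let ?H = "delete_verts G S"
  assume con: "Digraph_Component.connected ?H"
  interpret sym_digraph G by fact
  interpret H: sym_digraph ?H
    unfolding delete_verts_def by (rule induced_graph_imp_graph) (rule induced_induce, simp)
  \<comment> \<open>\<open>connected\<close> ignores arc directions whereas \<open>scc_of\<close>
    respects them; symmetry of the arcs, inherited by the induced subgraph, reconciles the two. Then
    every component is the whole vertex set.\<close>
  have sc: "strongly_connected ?H"
    using con H.symmetric_connected_imp_strongly_connected H.sym_arcs by blast
  have "H.scc_of u = verts ?H" if "u \<in> verts ?H" for u
    using sc that unfolding H.scc_of_def strongly_connected_def
    by (auto dest: H.reachable_in_verts)
  moreover have "x \<in> verts ?H" "y \<in> verts ?H"
    using assms(2,3) unfolding delete_verts_def vertex_cut_def nonadjacent_def by auto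
  ultimately show False
    using assms(3) unfolding vertex_cut_def by auto
qed

lemma finite_vertex_cut_cards:
  assumes "finite (verts G)"
  shows "finite {card S | S. vertex_cut G x y S}"
proof -
  have "{card S | S. vertex_cut G x y S} \<subseteq> card ` Pow (verts G)"
    unfolding vertex_cut_def by auto
  then show ?thesis
    using assms by (meson finite_Pow_iff finite_imageI finite_subset)
qed

lemma local_connectivity_le:
  assumes "finite (verts G)" "vertex_cut G x y S"
  shows "local_connectivity G x y \<le> card S"
  unfolding local_connectivity_def
  using finite_vertex_cut_cards[OF assms(1)] assms(2) by (auto intro!: Min_le)

lemma local_connectivity_attained:
  assumes "fin_digraph G" "nonadjacent G x y"
  obtains S where "vertex_cut G x y S" "card S = local_connectivity G x y"
proof -
  interpret fin_digraph G by fact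
  have "local_connectivity G x y \<in> {card S | S. vertex_cut G x y S}"
    unfolding local_connectivity_def
    using finite_vertex_cut_cards[OF finite_verts]
      vertex_cut_all_other_verts[OF wf_digraph assms(2)]
    by (intro Min_in) auto
  then show ?thesis
    using that by auto
qed

lemma max_local_connectivity_attained:
  assumes "finite (verts G)" "nonadjacent G u v"
  obtains x y where "nonadjacent G x y" "local_connectivity G x y = max_local_connectivity G"
proof -
  let ?L = "{local_connectivity G x y | x y. nonadjacent G x y}"
  have "?L \<subseteq> (\<lambda>(x, y). local_connectivity G x y) ` (verts G \<times> verts G)"
    unfolding nonadjacent_def by auto
  then have "finite ?L"
    using assms(1) by (meson finite_SigmaI finite_imageI finite_subset)
  then have "max_local_connectivity G \<in> ?L"
    unfolding max_local_connectivity_def using assms(2) by (intro Max_in) auto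
  then show ?thesis
    using that by auto
qed

lemma vertex_connectivity_le:
  assumes "finite (verts G)" "S \<subseteq> verts G" "\<not> Digraph_Component.connected (delete_verts G S)"
  shows "vertex_connectivity G \<le> card S"
proof -
  let ?C = "{card S | S. S \<subseteq> verts G \<and>
     (\<not> Digraph_Component.connected (delete_verts G S) \<or> card (verts G - S) = 1)}"
  have "?C \<subseteq> card ` Pow (verts G)" by auto
  then have "finite ?C"
    using assms(1) by (meson finite_Pow_iff finite_imageI finite_subset)
  then show ?thesis
    unfolding vertex_connectivity_def using assms(2,3) by (auto intro!: Min_le)
qed

text \<open>A minimum \<open>x\<close>-\<open>y\<close> cut disconnects \<open>G\<close>, so it
  competes in the minimum that defines \<open>vertex_connectivity\<close>.\<close>

lemma vertex_connectivity_le_local_connectivity: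
  assumes "graph G" "nonadjacent G x y"
  shows "vertex_connectivity G \<le> local_connectivity G x y"
proof -
  interpret graph G by fact
  obtain S where S: "vertex_cut G x y S" "card S = local_connectivity G x y"
    using local_connectivity_attained[OF fin_digraph assms(2)] .
  have "\<not> Digraph_Component.connected (delete_verts G S)"
    using vertex_cut_imp_disconnected[OF _ assms(2) S(1)] sym_digraphI sym_arcs by blast
  then show ?thesis
    using vertex_connectivity_le[of G S] S unfolding vertex_cut_def by auto
qed

text \<open>\<open>S\<close> contributes at most one color and each vertex outside it at most one
  more. The additive form avoids truncated subtraction.\<close>

lemma card_colors_le:
  assumes "finite V" "S \<subseteq> V" "monochromatic c S"
  shows "card (c ` V) + card S \<le> card V + 1"
proof -
  have fin: "finite S"
    using assms(1,2) finite_subset by blast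
  have "card (c ` S) \<le> 1"
  proof (cases "S = {}")
    case False
    then obtain u where "u \<in> S" by blast
    with assms(3) have "c ` S \<subseteq> {c u}"
      unfolding monochromatic_def by blast
    then show ?thesis
      using card_mono[of "{c u}" "c ` S"] by simp
  qed simp
  moreover have "card (c ` (V - S)) \<le> card V - card S"
    using card_image_le[of "V - S" c] assms(1) card_Diff_subset[OF fin assms(2)] by simp
  moreover have "c ` V = c ` S \<union> c ` (V - S)"
    using assms(2) by auto
  then have "card (c ` V) \<le> card (c ` S) + card (c ` (V - S))"
    by (simp add: card_Un_le)
  \<comment> \<open>This makes the natural-number difference \<open>card V - card S\<close>
    exact.\<close>
  moreover have "card S \<le> card V"
    using assms(1,2) by (rule card_mono)
  ultimately show ?thesis by linarith
qed

text \<open>Under a constant coloring every cut is monochromatic, so the existence of a cut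
  suffices.\<close>

lemma mvd_coloring_const:
  assumes "wf_digraph G"
  shows "mvd_coloring G (\<lambda>_. k)"
  unfolding mvd_coloring_def monochromatic_def using vertex_cut_all_other_verts[OF assms] by blast

lemma finite_mvd_coloring_cards:
  assumes "finite (verts G)"
  shows "finite {card (c ` verts G) | c. mvd_coloring G c}"
  \<comment> \<open>There are infinitely many colorings, but none uses more colors than there are
    vertices.\<close>
  by (rule finite_subset[of _ "{..card (verts G)}"]) (auto intro: card_image_le assms)

lemma mvd_attained:
  assumes "fin_digraph G"
  obtains c where "mvd_coloring G c" "card (c ` verts G) = mvd G"
proof -
  interpret fin_digraph G by fact
  have "mvd G \<in> {card (c ` verts G) | c. mvd_coloring G c}"
    unfolding mvd_def
    using finite_mvd_coloring_cards[OF finite_verts] mvd_coloring_const[OF wf_digraph]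
    by (intro Max_in) auto
  then show ?thesis
    using that by auto
qed

text \<open>An optimal coloring supplies a monochromatic \<open>x\<close>-\<open>y\<close> cut. It
  may be larger than a minimum cut, which only strengthens the bound.\<close>

lemma mvd_add_local_connectivity_le:
  assumes "fin_digraph G" "nonadjacent G x y"
  shows "mvd G + local_connectivity G x y \<le> card (verts G) + 1"
proof -
  interpret fin_digraph G by fact
  obtain c where c: "mvd_coloring G c" "card (c ` verts G) = mvd G"
    using mvd_attained[OF assms(1)] .
  then obtain S where S: "vertex_cut G x y S" "monochromatic c S"
    using assms(2) unfolding mvd_coloring_def by blast
  then have "mvd G + card S \<le> card (verts G) + 1"
    using card_colors_le[of "verts G" S c] c(2) unfolding vertex_cut_def by auto
  then show ?thesis
    using local_connectivity_le[OF finite_verts S(1)] by linarith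
qed

lemma mvd_pos:
  assumes "fin_digraph G" "verts G \<noteq> {}"
  shows "1 \<le> mvd G"
proof -
  interpret fin_digraph G by fact
  obtain c where "mvd_coloring G c" "card (c ` verts G) = mvd G"
    using mvd_attained[OF assms(1)] .
  moreover have "card (c ` verts G) \<noteq> 0"
    using assms(2) by simp
  ultimately show ?thesis by linarith
qed

theorem theorem1p1:
  fixes G :: "('a, 'b) pre_digraph" and n :: nat
  assumes "graph G"
    and "Digraph_Component.connected G"
    and "card (verts G) = n"
    and "\<not> complete_digraph n G"
  shows "1 \<le> mvd G
    \<and> int (mvd G) \<le> int n - int (max_local_connectivity G) + 1
    \<and> int n - int (max_local_connectivity G) + 1 \<le> int n - int (vertex_connectivity G) + 1"
proof -
  interpret graph G by fact
  obtain u v where "nonadjacent G u v"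
    using nonadjacent_if_not_complete assms(1,3,4) by blast
  \<comment> \<open>One pair attaining the maximum serves both the bound on \<open>mvd\<close> and
    the comparison with \<open>vertex_connectivity\<close>.\<close>
  then obtain x y where xy: "nonadjacent G x y"
      "local_connectivity G x y = max_local_connectivity G"
    using max_local_connectivity_attained[OF finite_verts] by blast
  have "verts G \<noteq> {}"
    using xy(1) unfolding nonadjacent_def by auto
  then have "1 \<le> mvd G"
    by (rule mvd_pos[OF fin_digraph])
  moreover have "mvd G + max_local_connectivity G \<le> n + 1"
    using mvd_add_local_connectivity_le[OF fin_digraph xy(1)] xy(2) assms(3) by simp
  moreover have "vertex_connectivity G \<le> max_local_connectivity G"
    using vertex_connectivity_le_local_connectivity[OF assms(1) xy(1)] xy(2) by simp
  ultimately show ?thesis by linarith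
qed

end
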